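(* The generating function for the weighted Euclidean billiard partitions is given by the following identity of formal power series in $q$ (with coefficients polynomials in $x$): $$ 1+\sum_{n\ge 1,\; m\ge 0}p_{\mathcal D}(m, n)\,x^m q^n \;=\; 1+\sum_{d=1}^\infty \sum_{n=0}^\infty \frac{s(d, n)}{(q^2;q^2)_d}, $$ where for all integers $d\ge 1$ and $n\ge 0$ $$ s(d, 2n)= x^{2n-d-1}\,q^{2n^2-2dn-n+d^2+2d}\begin{bmatrix} n-1\\ 2n-d-1\end{bmatrix}_{q^2}, \qquad s(d, 2n+1)= x^{2n-d}\,q^{2n^2-2dn+d^2+3n}\begin{bmatrix} n-1\\ 2n-d\end{bmatrix}_{q^2}. $$
   Context: $\mathcal D$ (the set of Euclidean billiard partitions) is the set of all integer partitions into distinct positive parts, $\pi=(\lambda_1>\lambda_2>\dots>\lambda_d)$ with $d\ge 1$, such that (E1) the smallest part $\lambda_d$ is even, and (E2) adjacent parts $\lambda_i,\lambda_{i+1}$ are never both odd. Weights: for $\pi\in\mathcal D$ with $d$ parts, largest part $N$ and exactly $s$ odd parts, the weight function is $\phi(N,d,\pi)=2^{d-1-2s}$ if $N$ is even, and $\phi(N,d,\pi)=2^{d-2s}$ if $N$ is odd. The exponent of $2$ here ($d-1-2s$ for $N$ even, $d-2s$ for $N$ odd) is the quantity recorded by the power of $x$: $p_{\mathcal D}(m,n)$ denotes the number of partitions $\pi\in\mathcal D$ of $n$ (i.e. whose parts sum to $n$) with $\phi(N,d,\pi)=2^m$, where $d$ and $N$ are the number of parts and the largest part of $\pi$. For example,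 $p_{\mathcal D}(0,15)=6$, $p_{\mathcal D}(1,15)=3$. Notation: $(a;q)_N=(1-a)(1-aq)\cdots(1-aq^{N-1})$, so $(q^2;q^2)_d=(1-q^2)(1-q^4)\cdots(1-q^{2d})$. The Gaussian polynomial $\begin{bmatrix} A\\ B\end{bmatrix}_q$ is $0$ if $B<0$ or $B>A$, and equals $\dfrac{(q;q)_A}{(q;q)_B(q;q)_{A-B}}$ if $0\le B\le A$; the subscript $q^2$ means $q$ is replaced by $q^2$. When the Gaussian polynomial factor vanishes, the product containing it is $0$ (even if the exponent of $x$ is negative). *)

theory Defs
  imports "HOL-Analysis.Analysis"
begin

text \<open>
  A partition into distinct parts is represented by the strictly decreasing list of its parts,
  so that \<^term>\<open>hd \<pi>\<close> is the largest and \<^term>\<open>last \<pi>\<close> the smallest part.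
\<close>

definition billiard_partitions :: "nat list set" where
  "billiard_partitions =
     {\<pi>. \<pi> \<noteq> [] \<and> (\<forall>p\<in>set \<pi>. p > 0) \<and> sorted_wrt (>) \<pi> \<and>
         even (last \<pi>) \<and>
         (\<forall>i. Suc i < length \<pi> \<longrightarrow> \<not> (odd (\<pi> ! i) \<and> odd (\<pi> ! Suc i)))}"

definition num_odd_parts :: "nat list \<Rightarrow> nat" where
  "num_odd_parts \<pi> = length (filter odd \<pi>)"

definition billiard_weight :: "nat \<Rightarrow> nat \<Rightarrow> nat list \<Rightarrow> rat" where
  "billiard_weight N d \<pi> =
     (if even N then 2 powi (int d - 1 - 2 * int (num_odd_parts \<pi>))
      else 2 powi (int d - 2 * int (num_odd_parts \<pi>)))"

definition p_D :: "nat \<Rightarrow> nat \<Rightarrow> nat" where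
  "p_D m n = card {\<pi> \<in> billiard_partitions.
     sum_list \<pi> = n \<and> billiard_weight (hd \<pi>) (length \<pi>) \<pi> = 2 ^ m}"

text \<open>
  Formal power series in \<open>q\<close> with coefficients polynomials in \<open>x\<close> are elements of \<^typ>\<open>int poly fps\<close>,
  with the library's \<open>q\<close>-adic topology: a series converges if each coefficient is eventually constant.
\<close>

definition qvar :: "int poly fps" where
  "qvar = fps_X"

definition xvar :: "int poly fps" where
  "xvar = fps_const [:0, 1:]"

text \<open>The library's theory of infinite sums needs continuity of addition.\<close>

lemma dist_fps_add_le:
  fixes x y a b :: "'a::ab_group_add fps"
  shows "dist (x + y) (a + b) \<le> max (dist x a) (dist y b)"
proof (cases "x = a \<or> y = b \<or> x + y = a + b")
  case True
  then show ?thesis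
    by (elim disjE) (simp_all add: dist_fps_def le_max_iff_disj)
next
  case False
  have eq: "(x + y) - (a + b) = (x - a) + (y - b)"
    by simp
  have "min (subdegree (x - a)) (subdegree (y - b)) \<le> subdegree ((x - a) + (y - b))"
    using False by (intro subdegree_add_ge) (auto simp: algebra_simps)
  then have "subdegree (x - a) \<le> subdegree ((x + y) - (a + b)) \<or>
             subdegree (y - b) \<le> subdegree ((x + y) - (a + b))"
    unfolding eq by linarith
  then have "inverse (2 ^ subdegree ((x + y) - (a + b)) :: real) \<le> inverse (2 ^ subdegree (x - a)) \<or>
             inverse (2 ^ subdegree ((x + y) - (a + b)) :: real) \<le> inverse (2 ^ subdegree (y - b))"
    by (elim disjE) (simp_all add: le_imp_inverse_le)
  then show ?thesis
    using False by (simp add: dist_fps_def le_max_iff_disj)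
qed

instance fps :: (ab_group_add) topological_comm_monoid_add
proof
  fix a b :: "'a fps"
  show "((\<lambda>x. fst x + snd x) \<longlongrightarrow> a + b) (nhds a \<times>\<^sub>F nhds b)"
  proof (rule tendstoI)
    fix e :: real assume e: "e > 0"
    have A: "eventually (\<lambda>x. dist x a < e) (nhds a)" "eventually (\<lambda>x. dist x b < e) (nhds b)"
      using e by (auto simp: eventually_nhds_metric)
    have B: "dist (x + y) (a + b) < e" if "dist x a < e" "dist y b < e" for x y
      using dist_fps_add_le[of x y a b] that by linarith
    show "eventually (\<lambda>x. dist (fst x + snd x) (a + b) < e) (nhds a \<times>\<^sub>F nhds b)"
      unfolding eventually_prod_filter
      by (intro exI[of _ "\<lambda>x. dist x a < e"] exI[of _ "\<lambda>x. dist x b < e"]) (simp add: A B)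
  qed
qed

text \<open>
  \<^typ>\<open>int poly\<close> has no multiplicative inverse operation, so the library's \<open>inverse\<close> on power series
  does not apply; for a power series with constant coefficient 1, the following is its reciprocal.
\<close>

definition fps_recip :: "'a::comm_ring_1 fps \<Rightarrow> 'a fps" where
  "fps_recip f = fps_right_inverse f 1"

lemma fps_recip: "fps_nth f 0 = 1 \<Longrightarrow> f * fps_recip f = 1"
  unfolding fps_recip_def by (rule fps_right_inverse) simp

definition qpoch :: "'a::comm_ring_1 \<Rightarrow> 'a \<Rightarrow> nat \<Rightarrow> 'a" where
  "qpoch a q N = (\<Prod>k<N. 1 - a * q ^ k)"

lemma qpoch_nth_0: "fps_nth q 0 = 0 \<Longrightarrow> fps_nth (qpoch q q N) 0 = 1"
  by (induction N) (simp_all add: qpoch_def)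

definition gauss_poly :: "int \<Rightarrow> int \<Rightarrow> 'a::comm_ring_1 fps \<Rightarrow> 'a fps" where
  "gauss_poly A B q =
     (if 0 \<le> B \<and> B \<le> A
      then qpoch q q (nat A) * fps_recip (qpoch q q (nat B) * qpoch q q (nat (A - B)))
      else 0)"

text \<open>
  In the next two definitions, \<^const>\<open>nat\<close> truncates the exponent of \<open>x\<close> only if the lower entry
  of the Gaussian polynomial (the same integer) is negative, and then the product is 0. The exponents
  of \<open>q\<close> are never negative: they are \<open>n\<^sup>2 + (n - d)\<^sup>2 - n + 2 d\<close> and \<open>n\<^sup>2 + (n - d)\<^sup>2 + 3 n\<close>.
\<close>

definition s_even :: "nat \<Rightarrow> nat \<Rightarrow> int poly fps" where
  "s_even d n =
     xvar ^ nat (2 * int n - int d - 1) *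
     qvar ^ nat (2 * int n ^ 2 - 2 * int d * int n - int n + int d ^ 2 + 2 * int d) *
     gauss_poly (int n - 1) (2 * int n - int d - 1) (qvar ^ 2)"

definition s_odd :: "nat \<Rightarrow> nat \<Rightarrow> int poly fps" where
  "s_odd d n =
     xvar ^ nat (2 * int n - int d) *
     qvar ^ nat (2 * int n ^ 2 - 2 * int d * int n + int d ^ 2 + 3 * int n) *
     gauss_poly (int n - 1) (2 * int n - int d) (qvar ^ 2)"

definition s_term :: "nat \<Rightarrow> nat \<Rightarrow> int poly fps" where
  "s_term d k = (if even k then s_even d (k div 2) else s_odd d (k div 2))"

definition s_quot :: "nat \<Rightarrow> nat \<Rightarrow> int poly fps" where
  "s_quot d n = s_term d n * fps_recip (qpoch (qvar ^ 2) (qvar ^ 2) d)"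

end

theory Submission
  imports Defs
begin

text \<open>
  Fix the parity of the largest part, the number n of even parts and the number s of odd parts, and
  let d = n + s. Subtracting 2 from every part either gives another such partition, or the smallest
  part was 2 or 1. After a 2 is removed, the other parts reduced by 2 form an arbitrary partition of
  this kind; after a 1 is removed, the other parts, unreduced, form an arbitrary one whose smallest
  part is even. Hence the generating function times
  (1 - q^(2 d)) is expressed by those with one part less, and multiplying by (q^2; q^2)_d leaves
  numerators with a recurrence that is, up to a power of q, the q-Pascal rule
  [k+1, s+1] = q^(2(s+1)) [k, s+1] + [k, s]. This identifies the numerators with a Gaussian
  polynomial times a power of q; the term with index k on the right-hand side counts the partitions
  with k div 2 even parts and largest part of the parity of k, so for fixed d it vanishes for
  k > 2 d + 1.
\<close>

subsection \<open>Convergence of power series\<close>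

text \<open>Distinct series that agree up to coefficient N have distance below
  \<open>inverse (2 ^ N)\<close>, so closeness to the limit tests only finitely many
  coefficients.\<close>

lemma tendsto_fpsI:
  fixes f :: "'b \<Rightarrow> 'a::ab_group_add fps"
  assumes "\<And>n. eventually (\<lambda>i. fps_nth (f i) n = fps_nth F n) G"
  shows "(f \<longlongrightarrow> F) G"
proof (rule tendstoI)
  fix e :: real assume "e > 0"
  then obtain N where N: "inverse (2 ^ N) < e"
    using real_arch_pow_inv[of e "inverse 2"] by (auto simp: power_divide inverse_eq_divide)
  have "eventually (\<lambda>i. \<forall>n\<in>{..N}. fps_nth (f i) n = fps_nth F n) G"
    by (rule eventually_ball_finite) (use assms in auto)
  then show "eventually (\<lambda>i. dist (f i) F < e) G"
  proof eventually_elim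
    case (elim i)
    show ?case
    proof (cases "f i = F")
      case False
      then have "N < subdegree (f i - F)"
        using elim by (intro subdegree_greaterI) auto
      then have "inverse (2 ^ subdegree (f i - F)) \<le> inverse (2 ^ N :: real)"
        by (intro le_imp_inverse_le power_increasing) auto
      also note N
      finally show ?thesis
        using False by (simp add: dist_fps_def)
    qed (use \<open>e > 0\<close> in simp)
  qed
qed

text \<open>A finite partial sum over a set containing \<open>T n\<close> already has the final
  coefficient of index n, as all other terms contribute 0 to it. Each infinite sum below is
  evaluated in this way.\<close>

lemma has_sum_fpsI:
  fixes f :: "'b \<Rightarrow> 'a::ab_group_add fps"
  assumes "\<And>n. finite (T n)" "\<And>n. T n \<subseteq> A"
    and "\<And>n i. i \<in> A - T n \<Longrightarrow> fps_nth (f i) n = 0"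
    and "\<And>n. (\<Sum>i\<in>T n. fps_nth (f i) n) = fps_nth F n"
  shows "(f has_sum F) A"
  unfolding has_sum_def
proof (rule tendsto_fpsI)
  fix n
  have "fps_nth (sum f X) n = fps_nth F n" if X: "finite X" "T n \<subseteq> X" "X \<subseteq> A" for X
  proof -
    have "fps_nth (sum f X) n = (\<Sum>i\<in>X. fps_nth (f i) n)"
      by (simp add: fps_sum_nth)
    also have "\<dots> = (\<Sum>i\<in>T n. fps_nth (f i) n)"
      using X assms(3) by (intro sum.mono_neutral_right) auto
    finally show ?thesis by (simp add: assms(4))
  qed
  then show "\<forall>\<^sub>F X in finite_subsets_at_top A. fps_nth (sum f X) n = fps_nth F n"
    unfolding eventually_finite_subsets_at_top
    by (intro exI[of _ "T n"]) (simp add: assms(1,2))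
qed

subsection \<open>Generating functions of sets of lists\<close>

text \<open>A general weight covers plain counting (constantly 1) as well as marking by powers of x.
  An infinite fibre would get the default value 0 of \<open>sum\<close>;
  \<open>finite_positive_lists\<close> excludes this for positive parts.\<close>

definition list_gf :: "(nat list \<Rightarrow> 'a::comm_ring_1) \<Rightarrow> nat list set \<Rightarrow> 'a fps" where
  "list_gf w S = Abs_fps (\<lambda>n. \<Sum>\<rho> | \<rho> \<in> S \<and> sum_list \<rho> = n. w \<rho>)"

lemma length_le_sum_list:
  fixes \<rho> :: "nat list"
  shows "0 \<notin> set \<rho> \<Longrightarrow> length \<rho> \<le> sum_list \<rho>"
  by (induction \<rho>) auto

text \<open>With positive entries, the sum bounds both the entries and the length.\<close>

lemma finite_positive_lists:
  assumes "\<And>\<rho>. \<rho> \<in> S \<Longrightarrow> 0 \<notin> set \<rho>"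
  shows "finite {\<rho>\<in>S. sum_list \<rho> = (n::nat)}"
proof (rule finite_subset)
  show "{\<rho>\<in>S. sum_list \<rho> = n} \<subseteq> {\<rho>. set \<rho> \<subseteq> {..n} \<and> length \<rho> \<le> n}"
    using assms by (auto intro: member_le_sum_list length_le_sum_list)
qed (simp add: finite_lists_length_le)

lemma list_gf_empty [simp]: "list_gf w {} = 0"
  by (simp add: list_gf_def fps_eq_iff)

lemma list_gf_Union:
  assumes I: "finite I" and disj: "\<And>i j. i \<in> I \<Longrightarrow> j \<in> I \<Longrightarrow> i \<noteq> j \<Longrightarrow> S i \<inter> S j = {}"
    and pos: "\<And>i \<rho>. i \<in> I \<Longrightarrow> \<rho> \<in> S i \<Longrightarrow> 0 \<notin> set \<rho>"
  shows "list_gf w (\<Union>i\<in>I. S i) = (\<Sum>i\<in>I. list_gf w (S i))"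
proof (rule fps_ext)
  fix n
  have "{\<rho>. \<rho> \<in> (\<Union>i\<in>I. S i) \<and> sum_list \<rho> = n} = (\<Union>i\<in>I. {\<rho>\<in>S i. sum_list \<rho> = n})"
    by blast
  then have "fps_nth (list_gf w (\<Union>i\<in>I. S i)) n = sum w (\<Union>i\<in>I. {\<rho>\<in>S i. sum_list \<rho> = n})"
    by (simp add: list_gf_def)
  also have "\<dots> = (\<Sum>i\<in>I. sum w {\<rho>\<in>S i. sum_list \<rho> = n})"
    using disj by (intro sum.UNION_disjoint I ballI finite_positive_lists pos) blast+
  finally show "fps_nth (list_gf w (\<Union>i\<in>I. S i)) n = fps_nth (\<Sum>i\<in>I. list_gf w (S i)) n"
    by (simp add: list_gf_def fps_sum_nth)
qed

lemma list_gf_Un: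
  assumes "S \<inter> T = {}" "\<And>\<rho>. \<rho> \<in> S \<union> T \<Longrightarrow> 0 \<notin> set \<rho>"
  shows "list_gf w (S \<union> T) = list_gf w S + list_gf w T"
proof -
  have "list_gf w (\<Union>b\<in>{True, False}. if b then S else T)
    = (\<Sum>b\<in>{True, False}. list_gf w (if b then S else T))"
    using assms by (intro list_gf_Union) (auto split: if_splits)
  then show ?thesis by (simp add: Un_commute add.commute)
qed

lemma list_gf_image:
  assumes inj: "inj_on f S" and sum: "\<And>\<rho>. \<rho> \<in> S \<Longrightarrow> sum_list (f \<rho>) = sum_list \<rho> + k"
    and w: "\<And>\<rho>. \<rho> \<in> S \<Longrightarrow> w (f \<rho>) = w \<rho>"
  shows "list_gf w (f ` S) = fps_X ^ k * list_gf w S"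
proof (rule fps_ext)
  fix n
  have "fps_nth (list_gf w (f ` S)) n = sum w (f ` {\<rho>\<in>S. sum_list \<rho> + k = n})"
    unfolding list_gf_def fps_nth_Abs_fps using sum by (intro arg_cong[of _ _ "sum w"]) auto
  also have "\<dots> = sum w {\<rho>\<in>S. sum_list \<rho> + k = n}"
    by (subst sum.reindex) (use inj w in \<open>auto simp: inj_on_def\<close>)
  also have "\<dots> = fps_nth (fps_X ^ k * list_gf w S) n"
    by (cases "n < k") (auto simp: fps_X_power_mult_nth list_gf_def intro!: sum.cong)
  finally show "fps_nth (list_gf w (f ` S)) n = fps_nth (fps_X ^ k * list_gf w S) n" .
qed

lemma list_gf_cong_const:
  assumes "\<And>\<rho>. \<rho> \<in> S \<Longrightarrow> w \<rho> = c"
  shows "list_gf w S = fps_const c * list_gf (\<lambda>_. 1) S"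
  using assms by (auto simp: fps_eq_iff list_gf_def sum_distrib_left intro!: sum.cong)

subsection \<open>Decomposition by the smallest part\<close>

definition billiard_step :: "nat \<Rightarrow> nat \<Rightarrow> bool" where
  "billiard_step a b \<longleftrightarrow> a < b \<and> \<not> (odd a \<and> odd b)"

text \<open>
  Partitions are handled as increasing lists, the reverse of the order in \<^const>\<open>billiard_partitions\<close>,
  so that the smallest part is at the head. The smallest part may be odd here, since this happens
  after the removal of an even smallest part. The indices count the even and the odd parts
  (instead of all parts and the odd ones), which keeps the exponents below free of subtraction.
\<close>

definition billiard_chains :: "bool \<Rightarrow> bool \<Rightarrow> nat \<Rightarrow> nat \<Rightarrow> nat list set" where
  "billiard_chains e t n s = {\<rho>. \<rho> \<noteq> [] \<and> successively billiard_step \<rho> \<and> 0 < hd \<rho> \<and>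
     odd (hd \<rho>) = e \<and> odd (last \<rho>) = t \<and>
     length (filter even \<rho>) = n \<and> length (filter odd \<rho>) = s}"

lemma successively_billiard_step_sorted:
  "successively billiard_step \<rho> \<Longrightarrow> sorted_wrt (<) \<rho>"
  by (rule successively_conv_sorted_wrt[THEN iffD1, OF transp_on_less], erule successively_mono)
    (simp add: billiard_step_def)

lemma billiard_chain_ge_hd:
  assumes "successively billiard_step \<rho>" "x \<in> set \<rho>"
  shows "hd \<rho> \<le> x"
  using successively_billiard_step_sorted[OF assms(1)] assms(2) by (cases \<rho>) auto

lemma billiard_chains_pos: "\<rho> \<in> billiard_chains e t n s \<Longrightarrow> 0 \<notin> set \<rho>"
  using billiard_chain_ge_hd[of \<rho> 0] by (auto simp: billiard_chains_def)

section \<open>Shifting all parts by 2\<close>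

lemma successively_billiard_step_map:
  "successively billiard_step (map ((+) 2) \<rho>) \<longleftrightarrow> successively billiard_step \<rho>"
  by (simp add: successively_map billiard_step_def)

text \<open>As 2 is even, only the order matters, and it amounts to positivity of the unshifted next
  part, which is the condition on \<open>hd\<close> in \<open>billiard_chains\<close>. The form
  \<open>Suc (Suc x)\<close> is what simplification makes of \<open>2 + x\<close>.\<close>

lemma billiard_step_2: "billiard_step 2 (Suc (Suc x)) \<longleftrightarrow> 0 < x"
  by (simp add: billiard_step_def)

lemma filter_parity_shift:
  "filter (even \<circ> (+) (2::nat)) \<rho> = filter even \<rho>"
  "filter (odd \<circ> (+) (2::nat)) \<rho> = filter odd \<rho>"
  by (simp_all add: o_def)

lemma length_even_odd: "length \<rho> = length (filter even \<rho>) + length (filter odd (\<rho> :: nat list))"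
  by (induction \<rho>) auto

lemma length_billiard_chains: "\<rho> \<in> billiard_chains e t n s \<Longrightarrow> length \<rho> = n + s"
  using length_even_odd[of \<rho>] by (simp add: billiard_chains_def)

lemma sum_list_map_add: "sum_list (map ((+) 2) \<rho>) = sum_list \<rho> + 2 * length (\<rho> :: nat list)"
  by (induction \<rho>) auto

lemma map_add_in_billiard_chains:
  "\<rho> \<in> billiard_chains e t n s \<Longrightarrow> map ((+) 2) \<rho> \<in> billiard_chains e t n s"
  unfolding billiard_chains_def
  by (simp add: successively_billiard_step_map filter_map filter_parity_shift hd_map last_map)

text \<open>The head is the smallest part, so if it exceeds 2, subtracting 2 truncates nowhere and
  leaves positive parts. The conditions are listed one by one so that the lemma also applies to the
  tail of a chain.\<close>

lemma billiard_chains_unshift: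
  assumes "\<rho> \<noteq> []" "successively billiard_step \<rho>" "2 < hd \<rho>"
    "odd (hd \<rho>) = e" "odd (last \<rho>) = t" "length (filter even \<rho>) = n" "length (filter odd \<rho>) = s"
  shows "\<exists>\<sigma>\<in>billiard_chains e t n s. \<rho> = map ((+) 2) \<sigma>"
proof -
  define \<sigma> where "\<sigma> = map (\<lambda>x. x - 2) \<rho>"
  have "2 + (x - 2) = x" if "x \<in> set \<rho>" for x
    using billiard_chain_ge_hd[OF assms(2) that] assms(3) by linarith
  then have eq: "\<rho> = map ((+) 2) \<sigma>"
    by (simp add: \<sigma>_def o_def map_idI)
  have "\<sigma> \<noteq> []" using assms(1) by (simp add: \<sigma>_def)
  then have "\<sigma> \<in> billiard_chains e t n s"
    using assms unfolding eq billiard_chains_def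
    by (simp add: successively_billiard_step_map filter_map filter_parity_shift hd_map last_map)
  with eq show ?thesis by blast
qed


text \<open>An even smallest part is 2 or at least 4. If it is 2, the remaining parts exceed 2 and
  the next one may have either parity, whence the union. Some part remains because
  \<open>n + s > 0\<close>.\<close>

lemma billiard_chains_even_step:
  assumes "n + s > 0"
  shows "billiard_chains False t (Suc n) s = map ((+) 2) ` billiard_chains False t (Suc n) s \<union>
    (\<lambda>\<rho>. 2 # map ((+) 2) \<rho>) ` (billiard_chains False t n s \<union> billiard_chains True t n s)"
    (is "?A = _ ` ?A \<union> ?f ` ?B")
proof (intro equalityI subsetI)
  fix \<rho> assume \<rho>: "\<rho> \<in> ?A"
  then have hd: "hd \<rho> = 2 \<or> 2 < hd \<rho>"
    by (auto simp: billiard_chains_def elim!: evenE)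
  show "\<rho> \<in> map ((+) 2) ` ?A \<union> ?f ` ?B"
  proof (cases "hd \<rho> = 2")
    case True
    with \<rho> obtain \<tau> where \<tau>: "\<rho> = 2 # \<tau>"
      by (cases \<rho>) (auto simp: billiard_chains_def)
    with \<rho> assms have ne: "\<tau> \<noteq> []"
      by (auto simp: billiard_chains_def)
    have "\<exists>\<sigma>\<in>billiard_chains (odd (hd \<tau>)) t n s. \<tau> = map ((+) 2) \<sigma>"
      using \<rho> ne by (intro billiard_chains_unshift)
        (auto simp: \<tau> billiard_chains_def successively_Cons billiard_step_def)
    then show ?thesis
      unfolding \<tau> by (cases "odd (hd \<tau>)") auto
  next
    case False
    with hd \<rho> have "\<exists>\<sigma>\<in>?A. \<rho> = map ((+) 2) \<sigma>"
      by (intro billiard_chains_unshift) (auto simp: billiard_chains_def)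
    then show ?thesis by blast
  qed
next
  fix \<rho> assume "\<rho> \<in> map ((+) 2) ` ?A \<union> ?f ` ?B"
  then show "\<rho> \<in> ?A"
  proof
    assume "\<rho> \<in> ?f ` ?B"
    then show ?thesis
      by (auto simp: billiard_chains_def successively_Cons successively_billiard_step_map
          billiard_step_2 filter_map filter_parity_shift hd_map last_map)
  qed (auto intro: map_add_in_billiard_chains)
qed

text \<open>An odd smallest part is 1 or at least 3. The part after a 1 is even and may be 2, which
  a shift by 2 would turn into 0; so the remaining parts are left unshifted.\<close>

lemma billiard_chains_odd_step:
  assumes "n + s > 0"
  shows "billiard_chains True t n (Suc s) = map ((+) 2) ` billiard_chains True t n (Suc s) \<union>
    (#) 1 ` billiard_chains False t n s"
    (is "?A = _ ` ?A \<union> ?f ` ?B")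
proof (intro equalityI subsetI)
  fix \<rho> assume \<rho>: "\<rho> \<in> ?A"
  then have hd: "hd \<rho> = 1 \<or> 2 < hd \<rho>"
    by (auto simp: billiard_chains_def elim!: oddE)
  show "\<rho> \<in> map ((+) 2) ` ?A \<union> ?f ` ?B"
  proof (cases "hd \<rho> = 1")
    case True
    with \<rho> obtain \<tau> where \<tau>: "\<rho> = 1 # \<tau>"
      by (cases \<rho>) (auto simp: billiard_chains_def)
    with \<rho> assms have ne: "\<tau> \<noteq> []"
      by (auto simp: billiard_chains_def)
    then have "\<tau> \<in> ?B"
      using \<rho> by (auto simp: \<tau> billiard_chains_def successively_Cons billiard_step_def)
    then show ?thesis
      unfolding \<tau> by blast
  next
    case False
    with hd \<rho> have "\<exists>\<sigma>\<in>?A. \<rho> = map ((+) 2) \<sigma>"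
      by (intro billiard_chains_unshift) (auto simp: billiard_chains_def)
    then show ?thesis by blast
  qed
next
  fix \<rho> assume "\<rho> \<in> map ((+) 2) ` ?A \<union> ?f ` ?B"
  then show "\<rho> \<in> ?A"
  proof
    assume "\<rho> \<in> ?f ` ?B"
    then show ?thesis
      by (auto simp: billiard_chains_def successively_Cons billiard_step_def elim!: evenE)
  qed (auto intro: map_add_in_billiard_chains)
qed


text \<open>The least single part is 2 for n = 1 and 1 for n = 0, so n + 1 in both cases. Smallest
  and largest part coincide, which forces e = t.\<close>

lemma billiard_chains_single:
  assumes "n + s = 1" "e \<longleftrightarrow> s = 1"
  shows "billiard_chains e t n s = map ((+) 2) ` billiard_chains e t n s \<union>
    (if e = t then {[n + 1]} else {})"
    (is "?A = _ ` ?A \<union> ?B")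
proof (intro equalityI subsetI)
  fix \<rho> assume \<rho>: "\<rho> \<in> ?A"
  then have "length \<rho> = 1"
    using assms(1) by (simp add: length_billiard_chains)
  then obtain a where a: "\<rho> = [a]"
    by (auto simp: length_Suc_conv)
  show "\<rho> \<in> map ((+) 2) ` ?A \<union> ?B"
  proof (cases "2 < a")
    case True
    with \<rho> have "\<exists>\<sigma>\<in>?A. \<rho> = map ((+) 2) \<sigma>"
      by (intro billiard_chains_unshift) (auto simp: a billiard_chains_def)
    then show ?thesis by blast
  next
    case False
    then have "a = 0 \<or> a = 1 \<or> a = 2" by linarith
    with \<rho> assms show ?thesis
      by (auto simp: a billiard_chains_def)
  qed
next
  fix \<rho> assume "\<rho> \<in> map ((+) 2) ` ?A \<union> ?B"
  then show "\<rho> \<in> ?A"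
  proof
    assume "\<rho> \<in> ?B"
    moreover have "n = 0 \<and> s = 1 \<or> n = 1 \<and> s = 0"
      using assms(1) by linarith
    ultimately show ?thesis
      using assms(2) by (auto simp: billiard_chains_def split: if_splits)
  qed (auto intro: map_add_in_billiard_chains)
qed

lemma billiard_chains_odd_0: "billiard_chains True t n 0 = {}"
  by (auto simp: billiard_chains_def filter_empty_conv dest: hd_in_set)

lemma billiard_chains_even_0: "billiard_chains False t 0 s = {}"
  by (auto simp: billiard_chains_def filter_empty_conv dest: hd_in_set)

text \<open>Shifted chains have a head above 2, so they are disjoint from \<open>B\<close>. The
  shift adds 2 to each of n + s parts and thus multiplies the series by q^(2(n+s)); this term is
  moved to the left.\<close>

lemma list_gf_billiard_chains_peel:
  assumes split: "billiard_chains e t n s = map ((+) 2) ` billiard_chains e t n s \<union> B"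
    and B: "\<And>\<rho>. \<rho> \<in> B \<Longrightarrow> hd \<rho> \<le> 2"
  shows "list_gf (\<lambda>_. 1 :: 'a::comm_ring_1) (billiard_chains e t n s) * (1 - fps_X ^ (2 * (n + s)))
    = list_gf (\<lambda>_. 1) B"
proof -
  let ?A = "billiard_chains e t n s" and ?G = "list_gf (\<lambda>_. 1 :: 'a)"
  have "?G ?A = ?G (map ((+) 2) ` ?A \<union> B)"
    using split by simp
  also have "\<dots> = ?G (map ((+) 2) ` ?A) + ?G B"
  proof (rule list_gf_Un)
    show "map ((+) 2) ` ?A \<inter> B = {}"
    proof (intro equals0I)
      fix \<rho> assume "\<rho> \<in> map ((+) 2) ` ?A \<inter> B"
      then obtain \<sigma> where "\<sigma> \<in> ?A" "\<rho> = map ((+) 2) \<sigma>" "\<rho> \<in> B" by blast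
      with B[of \<rho>] show False
        by (simp add: billiard_chains_def hd_map)
    qed
    show "0 \<notin> set \<rho>" if "\<rho> \<in> map ((+) 2) ` ?A \<union> B" for \<rho>
      using that split billiard_chains_pos by blast
  qed
  also have "?G (map ((+) 2) ` ?A) = fps_X ^ (2 * (n + s)) * ?G ?A"
    by (rule list_gf_image)
      (auto simp: sum_list_map_add length_billiard_chains intro!: inj_on_subset[OF inj_mapI])
  finally show ?thesis
    by (simp add: algebra_simps)
qed

section \<open>Recurrences for the numerators\<close>

lemma list_gf_single: "list_gf (\<lambda>_. 1) {\<rho>} = fps_X ^ sum_list \<rho>"
proof (rule fps_ext)
  fix n
  have "{\<sigma>. \<sigma> \<in> {\<rho>} \<and> sum_list \<sigma> = n} = (if sum_list \<rho> = n then {\<rho>} else {})"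
    by auto
  then show "fps_nth (list_gf (\<lambda>_. 1) {\<rho>}) n = fps_nth (fps_X ^ sum_list \<rho>) n"
    by (simp add: list_gf_def fps_X_power_nth)
qed

text \<open>The last factor of this product is the one in
  \<open>list_gf_billiard_chains_peel\<close>, so the recurrences become free of
  denominators.\<close>

definition chain_numer :: "bool \<Rightarrow> bool \<Rightarrow> nat \<Rightarrow> nat \<Rightarrow> 'a::comm_ring_1 fps" where
  "chain_numer e t n s =
     list_gf (\<lambda>_. 1) (billiard_chains e t n s) * qpoch (fps_X ^ 2) (fps_X ^ 2) (n + s)"

lemma qpoch_Suc: "qpoch q q (Suc n) = qpoch q q n * (1 - q ^ Suc n)"
  by (simp add: qpoch_def)

lemma chain_numer_even_step:
  assumes "n + s > 0"
  shows "chain_numer False t (Suc n) s =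
    fps_X ^ (2 * (Suc n + s)) * (chain_numer False t n s + chain_numer True t n s)"
proof -
  let ?G = "list_gf (\<lambda>_. 1 :: 'a)" and ?P = "qpoch (fps_X ^ 2) (fps_X ^ 2) :: nat \<Rightarrow> 'a fps"
  let ?B = "billiard_chains False t n s \<union> billiard_chains True t n s"
  have "?G (billiard_chains False t (Suc n) s) * (1 - fps_X ^ (2 * (Suc n + s)))
    = ?G ((\<lambda>\<rho>. 2 # map ((+) 2) \<rho>) ` ?B)"
    using billiard_chains_even_step[OF assms, of t] by (rule list_gf_billiard_chains_peel) auto
  \<comment> \<open>The new part contributes 2 and the shift of the other n + s parts contributes
    2(n + s).\<close>
  also have "\<dots> = fps_X ^ (2 * (Suc n + s)) * ?G ?B"
    by (rule list_gf_image)
      (auto simp: sum_list_map_add length_billiard_chains intro!: inj_onI dest: map_injective)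
  also have "?G ?B = ?G (billiard_chains False t n s) + ?G (billiard_chains True t n s)"
  proof (rule list_gf_Un)
    show "billiard_chains False t n s \<inter> billiard_chains True t n s = {}"
      by (auto simp: billiard_chains_def)
  qed (use billiard_chains_pos in blast)
  finally have *: "?G (billiard_chains False t (Suc n) s) * (1 - fps_X ^ (2 * (Suc n + s)))
    = fps_X ^ (2 * (Suc n + s)) * (?G (billiard_chains False t n s) + ?G (billiard_chains True t n s))" .
  have "chain_numer False t (Suc n) s
    = ?G (billiard_chains False t (Suc n) s) * (1 - fps_X ^ (2 * (Suc n + s))) * ?P (n + s)"
    by (simp add: chain_numer_def qpoch_Suc mult_ac flip: power_mult power_Suc)
  then show ?thesis
    unfolding * chain_numer_def by (simp only: distrib_left distrib_right mult_ac)
qed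

lemma chain_numer_odd_step:
  assumes "n + s > 0"
  shows "chain_numer True t n (Suc s) = fps_X * chain_numer False t n s"
proof -
  let ?G = "list_gf (\<lambda>_. 1 :: 'a)" and ?P = "qpoch (fps_X ^ 2) (fps_X ^ 2) :: nat \<Rightarrow> 'a fps"
  have "?G (billiard_chains True t n (Suc s)) * (1 - fps_X ^ (2 * (n + Suc s)))
    = ?G ((#) 1 ` billiard_chains False t n s)"
    using billiard_chains_odd_step[OF assms, of t] by (rule list_gf_billiard_chains_peel) auto
  also have "\<dots> = fps_X ^ 1 * ?G (billiard_chains False t n s)"
    by (rule list_gf_image) auto
  finally have *: "?G (billiard_chains True t n (Suc s)) * (1 - fps_X ^ (2 * (n + Suc s)))
    = fps_X ^ 1 * ?G (billiard_chains False t n s)" .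
  have "chain_numer True t n (Suc s)
    = ?G (billiard_chains True t n (Suc s)) * (1 - fps_X ^ (2 * (n + Suc s))) * ?P (n + s)"
    by (simp add: chain_numer_def qpoch_Suc mult_ac flip: power_mult power_Suc)
  then show ?thesis
    unfolding * chain_numer_def by (simp add: mult_ac)
qed

lemma chain_numer_single:
  assumes "n + s = 1" "e \<longleftrightarrow> s = 1"
  shows "chain_numer e t n s = (if e = t then fps_X ^ (n + 1) else 0)"
proof -
  let ?G = "list_gf (\<lambda>_. 1 :: 'a)"
  have "?G (billiard_chains e t n s) * (1 - fps_X ^ (2 * (n + s)))
    = ?G (if e = t then {[n + 1]} else {})"
    using billiard_chains_single[OF assms]
    by (rule list_gf_billiard_chains_peel) (use assms(1) in \<open>auto split: if_splits\<close>)
  then show ?thesis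
    using assms(1) by (auto simp: chain_numer_def qpoch_def list_gf_single)
qed

lemma chain_numer_odd_0: "chain_numer True t n 0 = 0"
  by (simp add: chain_numer_def billiard_chains_odd_0)

lemma chain_numer_even_0: "chain_numer False t 0 s = 0"
  by (simp add: chain_numer_def billiard_chains_even_0)

subsection \<open>Gaussian polynomials\<close>

lemma gauss_poly_mult:
  assumes "fps_nth q 0 = 0"
  shows "gauss_poly (int (a + b)) (int a) q * (qpoch q q a * qpoch q q b) = qpoch q q (a + b)"
proof -
  have "fps_nth (qpoch q q a * qpoch q q b) 0 = 1"
    using assms by (simp add: qpoch_nth_0)
  from fps_recip[OF this] show ?thesis
    by (simp add: gauss_poly_def nat_add_distrib mult_ac)
qed

text \<open>The denominator has constant coefficient 1, hence is nonzero and can be cancelled in an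
  integral domain. This avoids calculations with \<open>fps_recip\<close>.\<close>

lemma gauss_poly_eqI:
  fixes q f :: "'a::idom fps"
  assumes q: "fps_nth q 0 = 0" and f: "f * (qpoch q q a * qpoch q q b) = qpoch q q (a + b)"
  shows "gauss_poly (int (a + b)) (int a) q = f"
proof -
  have "fps_nth (qpoch q q a * qpoch q q b) 0 = 1"
    using q by (simp add: qpoch_nth_0)
  then have "qpoch q q a * qpoch q q b \<noteq> 0"
    by (metis fps_zero_nth zero_neq_one)
  then show ?thesis
    using gauss_poly_mult[OF q, of a b] f by (metis mult_right_cancel)
qed

lemma gauss_poly_0:
  fixes q :: "'a::idom fps"
  assumes "fps_nth q 0 = 0"
  shows "gauss_poly (int k) 0 q = 1"
  using gauss_poly_eqI[OF assms, of 1 0 k] by (simp add: qpoch_def)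

lemma gauss_poly_self:
  fixes q :: "'a::idom fps"
  assumes "fps_nth q 0 = 0"
  shows "gauss_poly (int k) (int k) q = 1"
  using gauss_poly_eqI[OF assms, of 1 k 0] by (simp add: qpoch_def)

lemma gauss_poly_eq_0: "B < 0 \<or> A < B \<Longrightarrow> gauss_poly A B q = 0"
  by (auto simp: gauss_poly_def)

lemma gauss_poly_sym: "gauss_poly A (A - B) q = gauss_poly A B q"
  by (auto simp: gauss_poly_def mult.commute)

text \<open>For s < k, denominators are cleared. For s = k the first summand vanishes and the other
  two Gaussian polynomials are 1; for s > k all three vanish.\<close>

lemma gauss_poly_pascal:
  fixes q :: "'a::idom fps"
  assumes q: "fps_nth q 0 = 0"
  shows "gauss_poly (int (Suc k)) (int (Suc s)) q =
    q ^ Suc s * gauss_poly (int k) (int (Suc s)) q + gauss_poly (int k) (int s) q"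
proof -
  consider "s < k" | "s = k" | "s > k" by linarith
  then show ?thesis
  proof cases
    case 1
    then obtain j where k: "k = Suc (s + j)"
      by (auto simp: less_iff_Suc_add)
    let ?P = "qpoch q q"
    define G H where "G = gauss_poly (int k) (int (Suc s)) q" and "H = gauss_poly (int k) (int s) q"
    have G: "G * (?P (Suc s) * ?P j) = ?P k"
      using gauss_poly_mult[OF q, of "Suc s" j] by (simp add: G_def k)
    have H: "H * (?P s * ?P (Suc j)) = ?P k"
      using gauss_poly_mult[OF q, of s "Suc j"] by (simp add: H_def k)
    have "gauss_poly (int (Suc s + Suc j)) (int (Suc s)) q = q ^ Suc s * G + H"
    proof (rule gauss_poly_eqI[OF q])
      \<comment> \<open>Relative to the common denominator, that of \<open>G\<close> lacks the
        factor with index j + 1 and that of \<open>H\<close> the one with index s + 1. The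
        coefficients then add up to 1 - q^(s+j+2).\<close>
      have "(q ^ Suc s * G + H) * (?P (Suc s) * ?P (Suc j))
        = q ^ Suc s * (1 - q ^ Suc j) * (G * (?P (Suc s) * ?P j))
          + (1 - q ^ Suc s) * (H * (?P s * ?P (Suc j)))"
        unfolding qpoch_Suc[of q j] qpoch_Suc[of q s] by (simp only: algebra_simps)
      also have "\<dots> = (1 - q ^ Suc (Suc s + j)) * ?P k"
        unfolding G H by (simp add: algebra_simps power_add)
      also have "\<dots> = ?P (Suc s + Suc j)"
        by (simp add: qpoch_Suc k)
      finally show "(q ^ Suc s * G + H) * (?P (Suc s) * ?P (Suc j)) = ?P (Suc s + Suc j)" .
    qed
    then show ?thesis
      by (simp add: G_def H_def k)
  next
    case 2
    then show ?thesis
      using gauss_poly_self[OF q, of k] gauss_poly_self[OF q, of "Suc k"]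
      by (simp add: gauss_poly_eq_0)
  qed (simp add: gauss_poly_eq_0)
qed

subsection \<open>Closed forms\<close>

text \<open>At most one odd part fits between consecutive even parts, so the s odd parts choose
  among k gaps. With n = k + 1, the exponent is the sum of 2, 4, ..., 2n and 3, 5, ..., 2s + 1, the
  least configuration when s \<le> k.\<close>

lemma chain_numer_even_top:
  "chain_numer False False (Suc k) s = (fps_X :: 'a::idom fps) ^ ((Suc k)\<^sup>2 + s\<^sup>2 + Suc k + 2 * s)
     * gauss_poly (int k) (int s) (fps_X ^ 2)"
proof (induction k arbitrary: s)
  case 0
  \<comment> \<open>For s = 1, removing the 2 leaves a single odd part, which
    \<open>chain_numer_odd_step\<close> does not cover.\<close>
  consider "s = 0" | "s = 1" | s' where "s = Suc (Suc s')"
    by (metis One_nat_def not0_implies_Suc)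
  then show ?case
  proof cases
    case 1
    then show ?thesis
      using gauss_poly_0[of "fps_X ^ 2 :: 'a fps" 0] by (simp add: chain_numer_single power2_eq_square)
  next
    case 2
    then show ?thesis
      by (simp add: chain_numer_even_step chain_numer_even_0 chain_numer_single gauss_poly_eq_0)
  next
    case 3
    then show ?thesis
      by (simp add: chain_numer_even_step chain_numer_odd_step chain_numer_even_0 gauss_poly_eq_0)
  qed
next
  case (Suc k)
  show ?case
  proof (cases s)
    case 0
    then show ?thesis
      using gauss_poly_0[of "fps_X ^ 2 :: 'a fps" k] gauss_poly_0[of "fps_X ^ 2 :: 'a fps" "Suc k"]
      by (simp add: chain_numer_even_step chain_numer_odd_0 Suc.IH power2_eq_square flip: power_add power_Suc)
  next
    case (Suc r)
    let ?X = "fps_X :: 'a fps"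
    have "chain_numer False False (Suc (Suc k)) (Suc r) = ?X ^ (2 * (Suc (Suc k) + Suc r)) *
      (?X ^ ((Suc k)\<^sup>2 + (Suc r)\<^sup>2 + Suc k + 2 * Suc r) * gauss_poly (int k) (int (Suc r)) (?X\<^sup>2)
       + ?X * (?X ^ ((Suc k)\<^sup>2 + r\<^sup>2 + Suc k + 2 * r) * gauss_poly (int k) (int r) (?X\<^sup>2)))"
      by (subst chain_numer_even_step) (simp_all only: chain_numer_odd_step Suc.IH add_Suc_right zero_less_Suc add_Suc)
    \<comment> \<open>With the target power factored out, the first summand retains q^(2(r+1)) and
      the second retains 1, as in the q-Pascal rule for q^2. After distributing, only equalities of
      exponents remain.\<close>
    also have "\<dots> = ?X ^ ((Suc (Suc k))\<^sup>2 + (Suc r)\<^sup>2 + Suc (Suc k) + 2 * Suc r) *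
      ((?X\<^sup>2) ^ Suc r * gauss_poly (int k) (int (Suc r)) (?X\<^sup>2) + gauss_poly (int k) (int r) (?X\<^sup>2))"
      unfolding distrib_left mult.assoc[symmetric] power_mult[symmetric] power_add[symmetric]
        power_Suc2[symmetric]
      by (intro arg_cong2[of _ _ _ _ "(+) :: 'a fps \<Rightarrow> _"] arg_cong2[of _ _ _ _ "(*) :: 'a fps \<Rightarrow> _"]
          arg_cong[of _ _ "power ?X"] refl)
        (simp_all add: power2_eq_square algebra_simps)
    finally show ?thesis
      using gauss_poly_pascal[of "?X\<^sup>2" k r] by (simp only: Suc) simp
  qed
qed

text \<open>One odd part lies above all even ones, and the other s - 1 choose among the k gaps. With
  n = k + 1, the exponent is the sum of 2, 4, ..., 2n, of 3, 5, ..., 2s - 1 and of the top part 2n +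
  1.\<close>

lemma chain_numer_odd_top:
  "chain_numer False True (Suc k) s = (fps_X :: 'a::idom fps) ^ ((Suc k)\<^sup>2 + s\<^sup>2 + 3 * Suc k)
     * gauss_poly (int k) (int s - 1) (fps_X ^ 2)"
proof (induction k arbitrary: s)
  case 0
  consider "s = 0" | "s = 1" | s' where "s = Suc (Suc s')"
    by (metis One_nat_def not0_implies_Suc)
  then show ?case
  proof cases
    case 1
    then show ?thesis
      by (simp add: chain_numer_single gauss_poly_eq_0)
  next
    case 2
    then show ?thesis
      using gauss_poly_0[of "fps_X ^ 2 :: 'a fps" 0]
      by (simp add: chain_numer_even_step chain_numer_even_0 chain_numer_single flip: power_Suc2)
  next
    case 3
    then show ?thesis
      by (simp add: chain_numer_even_step chain_numer_odd_step chain_numer_even_0 gauss_poly_eq_0)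
  qed
next
  case (Suc k)
  show ?case
  proof (cases s)
    case 0
    then show ?thesis
      by (simp add: chain_numer_even_step chain_numer_odd_0 Suc.IH gauss_poly_eq_0)
  next
    case (Suc r)
    let ?X = "fps_X :: 'a fps"
    \<comment> \<open>The lower entry is now s - 1 = r, so the rule is also required at r = 0, where
      the entry -1 gives 0.\<close>
    have pascal: "gauss_poly (int (Suc k)) (int r) (?X\<^sup>2)
      = (?X\<^sup>2) ^ r * gauss_poly (int k) (int r) (?X\<^sup>2) + gauss_poly (int k) (int r - 1) (?X\<^sup>2)"
    proof (cases r)
      case 0
      then show ?thesis
        using gauss_poly_0[of "?X\<^sup>2" k] gauss_poly_0[of "?X\<^sup>2" "Suc k"] by (simp add: gauss_poly_eq_0)
    next
      case (Suc j)
      then show ?thesis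
        using gauss_poly_pascal[of "?X\<^sup>2" k j] by simp
    qed
    have "chain_numer False True (Suc (Suc k)) (Suc r) = ?X ^ (2 * (Suc (Suc k) + Suc r)) *
      (?X ^ ((Suc k)\<^sup>2 + (Suc r)\<^sup>2 + 3 * Suc k) * gauss_poly (int k) (int (Suc r) - 1) (?X\<^sup>2)
       + ?X * (?X ^ ((Suc k)\<^sup>2 + r\<^sup>2 + 3 * Suc k) * gauss_poly (int k) (int r - 1) (?X\<^sup>2)))"
      by (subst chain_numer_even_step) (simp_all only: chain_numer_odd_step Suc.IH add_Suc_right zero_less_Suc add_Suc)
    also have "int (Suc r) - 1 = int r"
      by simp
    also have "?X ^ (2 * (Suc (Suc k) + Suc r)) *
      (?X ^ ((Suc k)\<^sup>2 + (Suc r)\<^sup>2 + 3 * Suc k) * gauss_poly (int k) (int r) (?X\<^sup>2)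
       + ?X * (?X ^ ((Suc k)\<^sup>2 + r\<^sup>2 + 3 * Suc k) * gauss_poly (int k) (int r - 1) (?X\<^sup>2)))
      = ?X ^ ((Suc (Suc k))\<^sup>2 + (Suc r)\<^sup>2 + 3 * Suc (Suc k)) *
      ((?X\<^sup>2) ^ r * gauss_poly (int k) (int r) (?X\<^sup>2) + gauss_poly (int k) (int r - 1) (?X\<^sup>2))"
      unfolding distrib_left mult.assoc[symmetric] power_mult[symmetric] power_add[symmetric]
        power_Suc2[symmetric]
      by (intro arg_cong2[of _ _ _ _ "(+) :: 'a fps \<Rightarrow> _"] arg_cong2[of _ _ _ _ "(*) :: 'a fps \<Rightarrow> _"]
          arg_cong[of _ _ "power ?X"] refl)
        (simp_all add: power2_eq_square algebra_simps)
    finally show ?thesis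
      by (simp only: pascal[symmetric] Suc) simp
  qed
qed

section \<open>Terms of the right-hand side as weighted generating functions\<close>

definition billiard_exponent :: "nat list \<Rightarrow> nat" where
  "billiard_exponent \<rho> =
     length (filter even \<rho>) - length (filter odd \<rho>) - (if even (last \<rho>) then 1 else 0)"

abbreviation billiard_monom :: "nat list \<Rightarrow> int poly" where
  "billiard_monom \<rho> \<equiv> [:0, 1:] ^ billiard_exponent \<rho>"

lemma list_gf_eq_chain_numer:
  "list_gf (\<lambda>_. 1) (billiard_chains e t n s)
    = chain_numer e t n s * fps_recip (qpoch (fps_X ^ 2) (fps_X ^ 2) (n + s))"
proof -
  have "qpoch (fps_X ^ 2) (fps_X ^ 2) (n + s)
      * fps_recip (qpoch (fps_X ^ 2) (fps_X ^ 2) (n + s) :: 'a fps) = 1"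
    by (intro fps_recip qpoch_nth_0) simp
  then show ?thesis
    by (simp add: chain_numer_def mult.assoc)
qed

lemma list_gf_billiard_monom_chains:
  "list_gf billiard_monom (billiard_chains e t n s)
    = xvar ^ (n - s - (if t then 0 else 1)) * list_gf (\<lambda>_. 1) (billiard_chains e t n s)"
  unfolding xvar_def fps_const_power
  by (rule list_gf_cong_const) (auto simp: billiard_chains_def billiard_exponent_def)

text \<open>For d = n + s the lower entry 2n - d - 1 is (n - 1) - s, so symmetry turns the Gaussian
  polynomial into that of \<open>chain_numer_even_top\<close>. For n = 0 both sides vanish.\<close>

lemma s_quot_eq_list_gf_even:
  "s_quot (n + s) (2 * n) = list_gf billiard_monom (billiard_chains False False n s)"
proof (cases n)
  case 0
  then show ?thesis
    by (simp add: s_quot_def s_term_def s_even_def gauss_poly_eq_0 billiard_chains_even_0)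
next
  case (Suc k)
  have "2 * int n ^ 2 - 2 * int (n + s) * int n - int n + int (n + s) ^ 2 + 2 * int (n + s)
      = int (n\<^sup>2 + s\<^sup>2 + n + 2 * s)"
    by (simp add: power2_eq_square algebra_simps)
  moreover have "nat (2 * int n - int (n + s) - 1) = n - s - 1"
    by linarith
  moreover have "gauss_poly (int n - 1) (2 * int n - int (n + s) - 1) (qvar\<^sup>2)
      = gauss_poly (int k) (int s) (qvar\<^sup>2)"
    using gauss_poly_sym[of "int k" "int s" "qvar\<^sup>2"] by (simp add: Suc algebra_simps)
  ultimately have "s_quot (n + s) (2 * n)
      = xvar ^ (n - s - 1) * chain_numer False False n s * fps_recip (qpoch (qvar\<^sup>2) (qvar\<^sup>2) (n + s))"
    by (simp only: s_quot_def s_term_def s_even_def even_mult_iff even_numeral simp_thms if_True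
        nonzero_mult_div_cancel_left nat_int Suc chain_numer_even_top qvar_def mult.assoc)
  then show ?thesis
    by (simp add: list_gf_billiard_monom_chains list_gf_eq_chain_numer qvar_def mult.assoc)
qed

text \<open>Here the lower entry 2n - d is (n - 1) - (s - 1), and symmetry leads to
  \<open>chain_numer_odd_top\<close>.\<close>

lemma s_quot_eq_list_gf_odd:
  "s_quot (n + s) (2 * n + 1) = list_gf billiard_monom (billiard_chains False True n s)"
proof (cases n)
  case 0
  have "gauss_poly (- 1) (- int s) (qvar\<^sup>2) = 0"
    by (rule gauss_poly_eq_0) linarith
  with 0 show ?thesis
    by (simp add: s_quot_def s_term_def s_odd_def billiard_chains_even_0)
next
  case (Suc k)
  have "2 * int n ^ 2 - 2 * int (n + s) * int n + int (n + s) ^ 2 + 3 * int n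
      = int (n\<^sup>2 + s\<^sup>2 + 3 * n)"
    by (simp add: power2_eq_square algebra_simps)
  moreover have "nat (2 * int n - int (n + s)) = n - s"
    by linarith
  moreover have "gauss_poly (int n - 1) (2 * int n - int (n + s)) (qvar\<^sup>2)
      = gauss_poly (int k) (int s - 1) (qvar\<^sup>2)"
    using gauss_poly_sym[of "int k" "int s - 1" "qvar\<^sup>2"] by (simp add: Suc algebra_simps)
  moreover have "(2 * n + 1) div 2 = n" "odd (2 * n + 1)"
    by simp_all
  ultimately have "s_quot (n + s) (2 * n + 1)
      = xvar ^ (n - s) * chain_numer False True n s * fps_recip (qpoch (qvar\<^sup>2) (qvar\<^sup>2) (n + s))"
    by (simp only: s_quot_def s_term_def s_odd_def simp_thms if_False
        nat_int Suc chain_numer_odd_top qvar_def mult.assoc)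
  then show ?thesis
    by (simp add: list_gf_billiard_monom_chains list_gf_eq_chain_numer qvar_def mult.assoc)
qed

lemma s_quot_eq_list_gf:
  assumes "k div 2 \<le> d"
  shows "s_quot d k = list_gf billiard_monom (billiard_chains False (odd k) (k div 2) (d - k div 2))"
proof (cases "even k")
  case True
  then show ?thesis
    using s_quot_eq_list_gf_even[of "k div 2" "d - k div 2"] assms by simp
next
  case False
  then show ?thesis
    using s_quot_eq_list_gf_odd[of "k div 2" "d - k div 2"] assms by simp
qed

text \<open>The lower entry of the Gaussian polynomial exceeds the upper one; there would be more
  even parts than parts.\<close>

lemma s_quot_eq_0: "d < k div 2 \<Longrightarrow> s_quot d k = 0"
  by (simp add: s_quot_def s_term_def s_even_def s_odd_def gauss_poly_eq_0)

subsection \<open>The two sides of the identity\<close>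

lemma rev_in_billiard_partitions_iff:
  "rev \<rho> \<in> billiard_partitions \<longleftrightarrow>
     \<rho> \<noteq> [] \<and> successively billiard_step \<rho> \<and> 0 < hd \<rho> \<and> even (hd \<rho>)"
proof -
  have "(\<forall>i. Suc i < length (rev \<rho>) \<longrightarrow> \<not> (odd (rev \<rho> ! i) \<and> odd (rev \<rho> ! Suc i)))
    \<longleftrightarrow> successively (\<lambda>a b. \<not> (odd a \<and> odd b)) \<rho>"
    using successively_rev[of "\<lambda>a b. \<not> (odd a \<and> odd b)" \<rho>]
    unfolding successively_conv_nth[of _ "rev \<rho>"] by (simp only: conj_commute)
  moreover have "successively billiard_step \<rho>
    \<longleftrightarrow> sorted_wrt (<) \<rho> \<and> successively (\<lambda>a b. \<not> (odd a \<and> odd b)) \<rho>"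
    unfolding successively_conv_sorted_wrt[OF transp_on_less, symmetric]
    by (auto simp: successively_conv_nth billiard_step_def)
  moreover have "(\<forall>p\<in>set \<rho>. 0 < p) \<longleftrightarrow> 0 < hd \<rho>" if "successively billiard_step \<rho>" "\<rho> \<noteq> []"
    using billiard_chain_ge_hd[OF that(1)] that(2) by (meson hd_in_set less_le_trans)
  ultimately show ?thesis
    by (auto simp: billiard_partitions_def sorted_wrt_rev last_rev)
qed

abbreviation "billiard_lists \<equiv> {\<rho>. rev \<rho> \<in> billiard_partitions}"

lemma billiard_lists_pos: "\<rho> \<in> billiard_lists \<Longrightarrow> 0 \<notin> set \<rho>"
  by (auto simp: billiard_partitions_def)

text \<open>Any two odd parts are separated by an even one, so the bound depends only on the
  parities of the two ends.\<close>

lemma num_odd_le_num_even: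
  assumes "successively billiard_step \<rho>" "\<rho> \<noteq> []"
  shows "length (filter odd \<rho>) + 1 \<le>
    length (filter even \<rho>) + of_bool (odd (hd \<rho>)) + of_bool (odd (last \<rho>))"
  using assms by (induction \<rho>) (auto simp: successively_Cons billiard_step_def of_bool_def split: if_splits)

text \<open>With n even and s odd parts, d - 2s = n - s. As the smallest part is even,
  \<open>num_odd_le_num_even\<close> gives s < n or s \<le> n according to the parity of the largest
  part, so the subtraction in \<open>billiard_exponent\<close> does not truncate.\<close>

lemma billiard_weight_rev:
  assumes "rev \<rho> \<in> billiard_partitions"
  shows "billiard_weight (hd (rev \<rho>)) (length (rev \<rho>)) (rev \<rho>) = 2 ^ billiard_exponent \<rho>"
proof -
  from assms have \<rho>: "\<rho> \<noteq> []" "even (hd \<rho>)" "successively billiard_step \<rho>"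
    by (auto simp: rev_in_billiard_partitions_iff)
  have odd: "num_odd_parts (rev \<rho>) = length (filter odd \<rho>)"
    by (simp add: num_odd_parts_def flip: rev_filter)
  have "int (length \<rho>) - 1 - 2 * int (length (filter odd \<rho>)) = int (billiard_exponent \<rho>)"
    if "even (last \<rho>)"
    using num_odd_le_num_even[OF \<rho>(3,1)] \<rho>(2) that length_even_odd[of \<rho>]
    by (simp add: billiard_exponent_def)
  moreover have "int (length \<rho>) - 2 * int (length (filter odd \<rho>)) = int (billiard_exponent \<rho>)"
    if "odd (last \<rho>)"
    using num_odd_le_num_even[OF \<rho>(3,1)] \<rho>(2) that length_even_odd[of \<rho>]
    by (simp add: billiard_exponent_def)
  ultimately show ?thesis
    using \<rho>(1) by (simp add: billiard_weight_def hd_rev odd)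
qed

lemma p_D_eq_card:
  "p_D m n = card {\<rho> \<in> billiard_lists. sum_list \<rho> = n \<and> billiard_exponent \<rho> = m}"
proof -
  have "{\<pi> \<in> billiard_partitions. sum_list \<pi> = n \<and> billiard_weight (hd \<pi>) (length \<pi>) \<pi> = 2 ^ m}
    = rev ` {\<rho> \<in> billiard_lists. sum_list \<rho> = n \<and> billiard_exponent \<rho> = m}"
    (is "?A = rev ` ?B")
  proof (intro equalityI subsetI)
    fix \<pi> assume "\<pi> \<in> ?A"
    then have "rev \<pi> \<in> ?B"
      using billiard_weight_rev[of "rev \<pi>"] by simp
    then show "\<pi> \<in> rev ` ?B"
      by (rule rev_image_eqI) simp
  next
    fix \<pi> assume "\<pi> \<in> rev ` ?B"
    then obtain \<rho> where "\<rho> \<in> ?B" "\<pi> = rev \<rho>" by blast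
    then show "\<pi> \<in> ?A"
      using billiard_weight_rev[of \<rho>] by simp
  qed
  then show ?thesis
    unfolding p_D_def by (simp add: card_image)
qed

section \<open>Coefficientwise summation of both sides\<close>

lemma billiard_exponent_le_sum:
  assumes "\<rho> \<in> billiard_lists"
  shows "billiard_exponent \<rho> \<le> sum_list \<rho>"
  using length_le_sum_list[OF billiard_lists_pos[OF assms]] length_even_odd[of \<rho>]
  by (auto simp: billiard_exponent_def)

lemma has_sum_p_D:
  "((\<lambda>(m, n). of_nat (p_D m n) * xvar ^ m * qvar ^ n) has_sum list_gf billiard_monom billiard_lists)
     {(m, n). n \<ge> 1}"
\<comment> \<open>Only pairs (m, N) reach the coefficient of q^N, and exponents above N do not
  occur. For N = 0 the index set offers no pair.\<close>
proof (rule has_sum_fpsI[where T = "\<lambda>N. if N = 0 then {} else (\<lambda>m. (m, N)) ` {..N}"])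
  have coeff: "fps_nth (of_nat (p_D m n) * xvar ^ m * qvar ^ n) N
      = (if n = N then of_nat (p_D m n) * [:0, 1:] ^ m else 0)" for m n N
    by (simp add: xvar_def qvar_def fps_X_power_mult_right_nth fps_const_power
        flip: fps_of_nat fps_const_mult)
  show "fps_nth (case i of (m, n) \<Rightarrow> of_nat (p_D m n) * xvar ^ m * qvar ^ n) N = 0"
    if i: "i \<in> {(m, n). n \<ge> 1} - (if N = 0 then {} else (\<lambda>m. (m, N)) ` {..N})" for N i
  proof -
    obtain m n where mn: "i = (m, n)" by fastforce
    have "p_D m n = 0" if "n = N"
    proof -
      have "n < m"
        using i that by (auto simp: mn split: if_splits)
      then have "billiard_exponent \<rho> \<noteq> m" if "\<rho> \<in> billiard_lists" "sum_list \<rho> = n" for \<rho>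
        using billiard_exponent_le_sum[OF that(1)] that(2) by simp
      then have "{\<rho> \<in> billiard_lists. sum_list \<rho> = n \<and> billiard_exponent \<rho> = m} = {}"
        by blast
      then show ?thesis
        by (simp only: p_D_eq_card card.empty)
    qed
    then show ?thesis
      by (simp add: mn coeff)
  qed
  show "(\<Sum>i\<in>(if N = 0 then {} else (\<lambda>m. (m, N)) ` {..N}).
      fps_nth (case i of (m, n) \<Rightarrow> of_nat (p_D m n) * xvar ^ m * qvar ^ n) N)
    = fps_nth (list_gf billiard_monom billiard_lists) N" for N
  proof (cases "N = 0")
    case True
    have "{\<rho>. \<rho> \<in> billiard_lists \<and> sum_list \<rho> = 0} = {}"
      by (auto simp: rev_in_billiard_partitions_iff dest: bspec[OF _ hd_in_set])
    then show ?thesis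
      by (simp only: True list_gf_def fps_nth_Abs_fps sum.empty if_True simp_thms)
  next
    case False
    let ?S = "{\<rho>. \<rho> \<in> billiard_lists \<and> sum_list \<rho> = N}"
    have "(\<Sum>m\<le>N. of_nat (p_D m N) * [:0, 1:] ^ m)
      = (\<Sum>m\<le>N. \<Sum>\<rho> | \<rho> \<in> ?S \<and> billiard_exponent \<rho> = m. billiard_monom \<rho>)"
      by (intro sum.cong) (simp_all add: p_D_eq_card)
    \<comment> \<open>The inner sums are the fibres of \<open>billiard_exponent\<close>, whose
      values on \<open>?S\<close> lie in \<open>{..N}\<close>.\<close>
    also have "\<dots> = (\<Sum>\<rho>\<in>?S. billiard_monom \<rho>)"
    proof (rule sum.group)
      show "finite ?S"
        by (rule finite_positive_lists) (rule billiard_lists_pos)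
      show "billiard_exponent ` ?S \<subseteq> {..N}"
        using billiard_exponent_le_sum by blast
    qed simp
    finally show ?thesis
      using False by (simp add: sum.reindex inj_on_def coeff list_gf_def)
  qed
qed auto

text \<open>The index k encodes the number of even parts as its half and the parity of the largest
  part as its own parity. At most d even parts means k \<le> 2d + 1.\<close>

lemma list_gf_billiard_lists_length:
  "list_gf billiard_monom {\<rho>\<in>billiard_lists. length \<rho> = d} = (\<Sum>k<2 * d + 2. s_quot d k)"
proof -
  let ?C = "\<lambda>k. billiard_chains False (odd k) (k div 2) (d - k div 2)"
  have "{\<rho>\<in>billiard_lists. length \<rho> = d} = (\<Union>k<2 * d + 2. ?C k)"
  proof (intro equalityI subsetI)
    fix \<rho> assume \<rho>: "\<rho> \<in> {\<rho>\<in>billiard_lists. length \<rho> = d}"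
    define k where "k = 2 * length (filter even \<rho>) + of_bool (odd (last \<rho>))"
    have "\<rho> \<in> ?C k"
      using \<rho> length_even_odd[of \<rho>]
      by (auto simp: k_def billiard_chains_def rev_in_billiard_partitions_iff)
    moreover have "k < 2 * d + 2"
      using \<rho> length_even_odd[of \<rho>] by (auto simp: k_def)
    ultimately show "\<rho> \<in> (\<Union>k<2 * d + 2. ?C k)" by blast
  next
    fix \<rho> assume "\<rho> \<in> (\<Union>k<2 * d + 2. ?C k)"
    then obtain k where k: "k < 2 * d + 2" "\<rho> \<in> ?C k" by blast
    then show "\<rho> \<in> {\<rho>\<in>billiard_lists. length \<rho> = d}"
      using length_billiard_chains[OF k(2)]
      by (auto simp: billiard_chains_def rev_in_billiard_partitions_iff)
  qed
  moreover have "?C i \<inter> ?C j = {}" if "i \<noteq> j" for i j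
  proof -
    have "odd i \<noteq> odd j \<or> i div 2 \<noteq> j div 2"
      using that by (metis bit_eq_rec)
    then show ?thesis
      by (auto simp: billiard_chains_def)
  qed
  ultimately have "list_gf billiard_monom {\<rho>\<in>billiard_lists. length \<rho> = d}
    = (\<Sum>k<2 * d + 2. list_gf billiard_monom (?C k))"
    by (simp only:) (intro list_gf_Union finite_lessThan billiard_chains_pos; blast)
  also have "\<dots> = (\<Sum>k<2 * d + 2. s_quot d k)"
    by (intro sum.cong refl s_quot_eq_list_gf[symmetric]) auto
  finally show ?thesis .
qed

lemma has_sum_s_quot:
  "(s_quot d has_sum list_gf billiard_monom {\<rho>\<in>billiard_lists. length \<rho> = d}) UNIV"
proof (rule has_sum_fpsI[where T = "\<lambda>_. {..<2 * d + 2}"])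
  show "(\<Sum>k<2 * d + 2. fps_nth (s_quot d k) n)
    = fps_nth (list_gf billiard_monom {\<rho>\<in>billiard_lists. length \<rho> = d}) n" for n
    by (simp only: list_gf_billiard_lists_length fps_sum_nth)
qed (auto simp: s_quot_eq_0)

text \<open>Since d positive parts sum to at least d, only d \<le> N reaches the coefficient of
  q^N.\<close>

lemma has_sum_list_gf_length:
  "((\<lambda>d. list_gf billiard_monom {\<rho>\<in>billiard_lists. length \<rho> = d}) has_sum
     list_gf billiard_monom billiard_lists) {1..}"
proof (rule has_sum_fpsI[where T = "\<lambda>N. {1..N}"])
  have le: "length \<rho> \<le> sum_list \<rho>" if "rev \<rho> \<in> billiard_partitions" for \<rho>
    using that by (intro length_le_sum_list billiard_lists_pos) simp
  show "fps_nth (list_gf billiard_monom {\<rho>\<in>billiard_lists. length \<rho> = d}) N = 0"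
    if "d \<in> {1..} - {1..N}" for d N
  proof -
    have "{\<rho>. \<rho> \<in> {\<rho>\<in>billiard_lists. length \<rho> = d} \<and> sum_list \<rho> = N} = {}"
      using that by (auto dest!: le)
    then show ?thesis
      by (simp only: list_gf_def fps_nth_Abs_fps sum.empty)
  qed
  show "(\<Sum>d\<in>{1..N}. fps_nth (list_gf billiard_monom {\<rho>\<in>billiard_lists. length \<rho> = d}) N)
    = fps_nth (list_gf billiard_monom billiard_lists) N" for N
  proof -
    let ?U = "\<Union>d\<in>{1..N}. {\<rho>\<in>billiard_lists. length \<rho> = d}"
    have "list_gf billiard_monom ?U
      = (\<Sum>d\<in>{1..N}. list_gf billiard_monom {\<rho>\<in>billiard_lists. length \<rho> = d})"
      by (rule list_gf_Union) (auto simp: billiard_partitions_def)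
    then have "(\<Sum>d\<in>{1..N}. fps_nth (list_gf billiard_monom {\<rho>\<in>billiard_lists. length \<rho> = d}) N)
      = fps_nth (list_gf billiard_monom ?U) N"
      by (simp only: fps_sum_nth)
    moreover have "{\<rho>. \<rho> \<in> ?U \<and> sum_list \<rho> = N}
      = {\<rho>. \<rho> \<in> billiard_lists \<and> sum_list \<rho> = N}"
      using le by (auto simp: billiard_partitions_def Suc_le_eq)
    ultimately show ?thesis
      by (simp only: list_gf_def fps_nth_Abs_fps)
  qed
qed auto

theorem theorem2p7:
  shows "(\<lambda>(m, n). of_nat (p_D m n) * xvar ^ m * qvar ^ n) summable_on {(m, n). n \<ge> 1}
    \<and> (\<forall>d\<ge>1. (\<lambda>n. s_quot d n) summable_on UNIV)
    \<and> (\<lambda>d. \<Sum>\<^sub>\<infinity>n\<in>UNIV. s_quot d n) summable_on {1..}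
    \<and> 1 + (\<Sum>\<^sub>\<infinity>(m, n)\<in>{(m, n). n \<ge> 1}. of_nat (p_D m n) * xvar ^ m * qvar ^ n)
      = 1 + (\<Sum>\<^sub>\<infinity>d\<in>{1..}. \<Sum>\<^sub>\<infinity>n\<in>UNIV. s_quot d n)"
proof -
  \<comment> \<open>Each inner sum is the part of the series with d parts; summed over d they give
    \<open>list_gf billiard_monom billiard_lists\<close>, which is also the sum on the left.\<close>
  have "(\<Sum>\<^sub>\<infinity>n\<in>UNIV. s_quot d n) = list_gf billiard_monom {\<rho>\<in>billiard_lists. length \<rho> = d}" for d
    by (rule infsumI[OF has_sum_s_quot])
  then have "((\<lambda>d. \<Sum>\<^sub>\<infinity>n\<in>UNIV. s_quot d n) has_sum list_gf billiard_monom billiard_lists) {1..}"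
    using has_sum_list_gf_length by simp
  then show ?thesis
    using has_sum_p_D has_sum_s_quot
    by (auto simp: infsumI dest: has_sum_imp_summable)
qed

end
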